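(* Let $A\in\mathbb{R}_+^{\infty\times\infty}$ satisfy $\mu(A)=r(A)$. Then the functions $r(\cdot)$ and $\mu(\cdot)$ on $(\mathbb{R}_+^{\infty\times\infty},d)$ are continuous at $A$.
   Context: $\mathbb{R}_+^{\infty\times\infty}$ is the set of infinite matrices $A=(a_{ij})_{i,j\in\mathbb{N}}$ with non-negative real entries and $\|A\|:=\sup\{a_{ij}:i,j\in\mathbb{N}\}<\infty$, with the metric $d(A,B)=\|A-B\|=\sup\{|a_{ij}-b_{ij}|:i,j\in\mathbb{N}\}$. The max-algebra product is $(A\otimes B)_{ij}=\sup_{k\in\mathbb{N}}a_{ik}b_{kj}$, and $A^k_\otimes$ is the $k$-th power of $A$ for $\otimes$. The max-algebra spectral radius is $r(A)=\lim_{k\to\infty}\|A^k_\otimes\|^{1/k}=\inf_k\|A^k_\otimes\|^{1/k}$ (the limit exists). For $i_0,\dots,i_k\in\mathbb{N}$ put $A(i_k,\dots,i_0)=\prod_{t=0}^{k-1}a_{i_{t+1}i_t}$, and define $\mu(A)=\sup\{A(i_1,i_k,\dots,i_2,i_1)^{1/k}:k\in\mathbb{N},\ i_1,\dots,i_k\in\mathbb{N}\}$. *)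

theory Defs
  imports "HOL-Analysis.Analysis"
begin

text \<open>
  Bounded non-negative matrices \<open>(a\<^sub>i\<^sub>j)\<close> with \<open>i, j \<in> \<nat>\<close>. The row and column indices
  start at 0, which only renames the index set.
\<close>

typedef bmat =
  "{a :: nat \<Rightarrow> nat \<Rightarrow> real. (\<forall>i j. 0 \<le> a i j) \<and> bdd_above (range (\<lambda>(i, j). a i j))}"
  morphisms entry Bmat
  by (rule exI[of _ "\<lambda>_ _. 0"]) auto

lemma entry_nonneg: "0 \<le> entry A i j"
  using entry[of A] by auto

lemma bdd_above_entry: "bdd_above (range (\<lambda>(i, j). entry A i j))"
  using entry[of A] by auto

lemma entry_Bmat:
  assumes "\<And>i j. 0 \<le> a i j" and "\<And>i j. a i j \<le> c"
  shows "entry (Bmat a) = a"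
  by (rule Bmat_inverse) (use assms in \<open>auto intro!: bdd_aboveI[of _ c]\<close>)

definition mat_norm :: "bmat \<Rightarrow> real" where
  "mat_norm A = (SUP (i, j). entry A i j)"

lemma entry_le_mat_norm: "entry A i j \<le> mat_norm A"
  unfolding mat_norm_def
  using cSUP_upper[OF UNIV_I bdd_above_entry[of A], of "(i, j)"] by simp

lemma mat_norm_nonneg: "0 \<le> mat_norm A"
  using entry_nonneg entry_le_mat_norm order_trans by blast

instantiation bmat :: metric_space
begin

definition dist_bmat :: "bmat \<Rightarrow> bmat \<Rightarrow> real" where
  "dist_bmat A B = (SUP (i, j). \<bar>entry A i j - entry B i j\<bar>)"

definition uniformity_bmat :: "(bmat \<times> bmat) filter" where
  "uniformity_bmat = (INF e\<in>{0<..}. principal {(A, B). dist A B < e})"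

definition open_bmat :: "bmat set \<Rightarrow> bool" where
  "open_bmat U = (\<forall>A\<in>U. eventually (\<lambda>(A', B). A' = A \<longrightarrow> B \<in> U) uniformity)"

instance
proof
  have bdd: "bdd_above (range (\<lambda>(i, j). \<bar>entry A i j - entry B i j\<bar>))" for A B
  proof (rule bdd_aboveI[of _ "mat_norm A + mat_norm B"], clarsimp)
    fix i j
    show "\<bar>entry A i j - entry B i j\<bar> \<le> mat_norm A + mat_norm B"
      using entry_nonneg[of A i j] entry_nonneg[of B i j]
        entry_le_mat_norm[of A i j] entry_le_mat_norm[of B i j] by linarith
  qed
  have upper: "\<bar>entry A i j - entry B i j\<bar> \<le> dist A B" for A B i j
    unfolding dist_bmat_def using cSUP_upper[OF UNIV_I bdd[of A B], of "(i, j)"] by simp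
  have least: "dist A B \<le> c" if "\<And>i j. \<bar>entry A i j - entry B i j\<bar> \<le> c" for A B c
    unfolding dist_bmat_def by (rule cSUP_least) (use that in auto)
  fix A B C :: bmat
  show "dist A B = 0 \<longleftrightarrow> A = B"
  proof
    assume "dist A B = 0"
    hence "entry A i j = entry B i j" for i j using upper[of A i j B] by simp
    hence "entry A = entry B" by blast
    thus "A = B" by (simp add: entry_inject)
  qed (simp add: dist_bmat_def case_prod_unfold)
  show "dist A B \<le> dist A C + dist B C"
  proof (rule least)
    fix i j
    show "\<bar>entry A i j - entry B i j\<bar> \<le> dist A C + dist B C"
      using upper[of A i j C] upper[of B i j C] by linarith
  qed
qed (rule uniformity_bmat_def open_bmat_def)+

end

definition max_mult :: "bmat \<Rightarrow> bmat \<Rightarrow> bmat" (infixl "\<otimes>\<^sub>m" 70) where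
  "A \<otimes>\<^sub>m B = Bmat (\<lambda>i j. SUP k. entry A i k * entry B k j)"

lemma entry_max_mult: "entry (A \<otimes>\<^sub>m B) i j = (SUP k. entry A i k * entry B k j)"
proof -
  have le: "entry A i k * entry B k j \<le> mat_norm A * mat_norm B" for i j k
    by (intro mult_mono entry_le_mat_norm entry_nonneg mat_norm_nonneg)
  hence bdd: "bdd_above (range (\<lambda>k. entry A i k * entry B k j))" for i j
    by (intro bdd_aboveI[of _ "mat_norm A * mat_norm B"]) auto
  have "0 \<le> (SUP k. entry A i k * entry B k j)" for i j
    by (rule cSUP_upper2[OF bdd UNIV_I[of 0]]) (simp add: entry_nonneg)
  moreover have "(SUP k. entry A i k * entry B k j) \<le> mat_norm A * mat_norm B" for i j
    by (rule cSUP_least) (use le in auto)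
  ultimately show ?thesis
    unfolding max_mult_def by (subst entry_Bmat) auto
qed

definition max_one :: bmat where
  "max_one = Bmat (\<lambda>i j. if i = j then 1 else 0)"

lemma entry_max_one: "entry max_one i j = (if i = j then 1 else 0)"
  unfolding max_one_def by (subst entry_Bmat[where c = 1]) auto

primrec max_power :: "bmat \<Rightarrow> nat \<Rightarrow> bmat" where
  "max_power A 0 = max_one"
| "max_power A (Suc k) = A \<otimes>\<^sub>m max_power A k"

lemma max_power_one: "max_power A 1 = A"
proof -
  have "(SUP k. entry A i k * entry max_one k j) = entry A i j" for i j
    by (rule cSup_eq_maximum)
      (auto simp: entry_max_one entry_nonneg intro: image_eqI[where x = j])
  thus ?thesis
    by (simp add: entry_max_mult flip: entry_inject add: fun_eq_iff)
qed

definition spectral_radius :: "bmat \<Rightarrow> real" where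
  "spectral_radius A = lim (\<lambda>k. root k (mat_norm (max_power A k)))"

text \<open>The weight \<open>A(i\<^sub>k, \<dots>, i\<^sub>0)\<close> of a path, given as a sequence \<open>i\<close> of which only
  \<open>i\<^sub>0, \<dots>, i\<^sub>k\<close> matter.\<close>

definition path_weight :: "bmat \<Rightarrow> nat \<Rightarrow> (nat \<Rightarrow> nat) \<Rightarrow> real" where
  "path_weight A k i = (\<Prod>t<k. entry A (i (Suc t)) (i t))"

text \<open>A cycle \<open>(i\<^sub>1, i\<^sub>k, \<dots>, i\<^sub>2, i\<^sub>1)\<close> of length \<open>k \<ge> 1\<close> is a path with \<open>k\<close> steps whose
  end points coincide.\<close>

definition cycle_mean_sup :: "bmat \<Rightarrow> real" where
  "cycle_mean_sup A = Sup {root k (path_weight A k i) | k i. 1 \<le> k \<and> i k = i 0}"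

lemma bdd_above_cycle_means:
  "bdd_above {root k (path_weight A k i) | k i. 1 \<le> k \<and> i k = i 0}"
proof (rule bdd_aboveI[of _ "mat_norm A"], clarsimp)
  fix k :: nat and i :: "nat \<Rightarrow> nat"
  assume k: "Suc 0 \<le> k"
  have "path_weight A k i \<le> (\<Prod>t<k. mat_norm A)"
    unfolding path_weight_def by (intro prod_mono) (simp add: entry_nonneg entry_le_mat_norm)
  hence "root k (path_weight A k i) \<le> root k (mat_norm A ^ k)"
    using k by simp
  thus "root k (path_weight A k i) \<le> mat_norm A"
    using k by (simp add: real_root_power_cancel mat_norm_nonneg)
qed

end

theory Submission imports Defs begin

text \<open>
  The function \<open>r\<close> is an infimum of continuous functions, hence upper semicontinuous, and \<open>\<mu>\<close> is
  a supremum of continuous functions, hence lower semicontinuous. Since \<open>\<mu> \<le> r\<close> everywhere, near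
  a point \<open>A\<close> with \<open>\<mu> A = r A\<close> both functions are squeezed between \<open>\<mu> A - \<epsilon>\<close> and \<open>r A + \<epsilon>\<close>.
\<close>

section \<open>Submultiplicative sequences\<close>

text \<open>Division of \<open>n\<close> by \<open>k\<close>: each block of length \<open>k\<close>
  split off costs a factor of at most \<open>q ^ k\<close>, and the remainder below \<open>k\<close>
  is absorbed into the constant \<open>K\<close>.\<close>

lemma submultiplicative_bound:
  fixes a :: "nat \<Rightarrow> real"
  assumes nonneg: "\<And>n. 0 \<le> a n" and submult: "\<And>m n. a (m + n) \<le> a m * a n"
    and k: "1 \<le> k" and q: "0 < q" and ak: "a k \<le> q ^ k"
  shows "\<exists>K>0. \<forall>n. a n \<le> K * q ^ n"
proof -
  \<comment> \<open>The sum dominates \<open>a s / q ^ s\<close> for every remainder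
    \<open>s < k\<close>; the summand 1 keeps \<open>K\<close> positive even if all these terms
    vanish.\<close>
  define K where "K = 1 + (\<Sum>s<k. a s / q ^ s)"
  have K: "0 < K"
    unfolding K_def using nonneg q by (intro add_pos_nonneg sum_nonneg) auto
  have "a n \<le> K * q ^ n" for n
  proof (induction n rule: less_induct)
    case (less n)
    show ?case
    proof (cases "n < k")
      case True
      have "a n / q ^ n \<le> (\<Sum>s<k. a s / q ^ s)"
        using True nonneg q by (intro member_le_sum) auto
      hence "a n / q ^ n \<le> K" unfolding K_def by simp
      thus ?thesis using q by (simp add: pos_divide_le_eq)
    next
      case False
      have "a n \<le> a k * a (n - k)"
        using submult[of k "n - k"] False by simp
      also have "\<dots> \<le> q ^ k * (K * q ^ (n - k))"
        using less[of "n - k"] False k by (intro mult_mono ak nonneg) (use q in auto)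
      also have "\<dots> = K * q ^ n"
        using False by (simp flip: power_add)
      finally show ?thesis .
    qed
  qed
  with K show ?thesis by blast
qed

text \<open>Fekete's lemma in multiplicative form, stated with roots instead of logarithms so that
  \<open>a n = 0\<close> is allowed. The infimum starts at 1 because \<open>root 0\<close> is
  constantly 0.\<close>

lemma submultiplicative_root_LIMSEQ:
  fixes a :: "nat \<Rightarrow> real"
  assumes nonneg: "\<And>n. 0 \<le> a n" and submult: "\<And>m n. a (m + n) \<le> a m * a n"
  shows "(\<lambda>n. root n (a n)) \<longlonglongrightarrow> (INF n\<in>{1..}. root n (a n))"
    (is "_ \<longlonglongrightarrow> ?L")
proof -
  have bdd: "bdd_below ((\<lambda>n. root n (a n)) ` {1..})"
    by (rule bdd_belowI[of _ 0]) (auto simp: nonneg)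
  have le: "?L \<le> root n (a n)" if "1 \<le> n" for n
    by (rule cINF_lower[OF bdd]) (use that in simp)
  show ?thesis
  proof (rule order_tendstoI)
    fix x assume x: "x < ?L"
    show "\<forall>\<^sub>F n in sequentially. x < root n (a n)"
      by (rule eventually_sequentiallyI[of 1]) (rule less_le_trans[OF x le])
  next
    fix x assume "?L < x"
    then obtain q where q: "?L < q" "q < x" using dense by blast
    then obtain k where k: "1 \<le> k" "root k (a k) < q"
      using cINF_less_iff[OF _ bdd] by auto
    have q0: "0 < q" using k(2) real_root_ge_zero[OF nonneg, of k k] by linarith
    have "a k = root k (a k) ^ k" using k nonneg by simp
    also have "\<dots> \<le> q ^ k" using k nonneg by (intro power_mono) auto
    finally obtain K where K: "0 < K" "\<And>n. a n \<le> K * q ^ n"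
      using submultiplicative_bound[of a, OF nonneg submult k(1) q0] by blast
    \<comment> \<open>The constant \<open>K\<close> disappears under the \<open>n\<close>-th root,
      and the gap \<open>q < x\<close> leaves room for the convergence.\<close>
    have "(\<lambda>n. root n K * q) \<longlonglongrightarrow> 1 * q"
      by (intro tendsto_intros LIMSEQ_root_const K)
    hence root_less: "\<forall>\<^sub>F n in sequentially. root n K * q < x"
      using q by (auto dest: order_tendstoD)
    have root_le: "root n (a n) \<le> root n K * q" if "1 \<le> n" for n
    proof -
      have "root n (a n) \<le> root n (K * q ^ n)" using that K by simp
      thus ?thesis using that q0 by (simp add: real_root_mult real_root_power_cancel)
    qed
    show "\<forall>\<^sub>F n in sequentially. root n (a n) < x"
      using root_less eventually_ge_at_top[of 1]
      by eventually_elim (rule le_less_trans[OF root_le])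
  qed
qed

section \<open>Continuity of the matrix operations\<close>

lemma abs_entry_diff_le_dist: "\<bar>entry A i j - entry B i j\<bar> \<le> dist A B"
proof -
  have "bdd_above (range (\<lambda>(i, j). \<bar>entry A i j - entry B i j\<bar>))"
  proof (rule bdd_aboveI[of _ "mat_norm A + mat_norm B"], clarsimp)
    fix i j
    show "\<bar>entry A i j - entry B i j\<bar> \<le> mat_norm A + mat_norm B"
      using entry_nonneg[of A i j] entry_nonneg[of B i j]
        entry_le_mat_norm[of A i j] entry_le_mat_norm[of B i j] by linarith
  qed
  from cSUP_upper[OF UNIV_I this, of "(i, j)"] show ?thesis
    unfolding dist_bmat_def by simp
qed

lemma dist_bmat_le:
  assumes "\<And>i j. \<bar>entry A i j - entry B i j\<bar> \<le> c"
  shows "dist A B \<le> c"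
  unfolding dist_bmat_def by (rule cSUP_least) (use assms in auto)

lemma mat_norm_le:
  assumes "\<And>i j. entry A i j \<le> c"
  shows "mat_norm A \<le> c"
  unfolding mat_norm_def by (rule cSUP_least) (use assms in auto)

lemma abs_mat_norm_diff_le_dist: "\<bar>mat_norm A - mat_norm B\<bar> \<le> dist A B"
proof -
  have "mat_norm A \<le> mat_norm B + dist A B" for A B
  proof (rule mat_norm_le)
    fix i j
    show "entry A i j \<le> mat_norm B + dist A B"
      using abs_entry_diff_le_dist[of A i j B] entry_le_mat_norm[of B i j] by linarith
  qed
  from this[of A B] this[of B A] show ?thesis by (simp add: dist_commute)
qed

lemma mult_le_entry_max_mult: "entry A i k * entry B k j \<le> entry (A \<otimes>\<^sub>m B) i j"
proof -
  have "entry A i k * entry B k j \<le> mat_norm A * mat_norm B" for k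
    by (intro mult_mono entry_le_mat_norm entry_nonneg mat_norm_nonneg)
  hence "bdd_above (range (\<lambda>k. entry A i k * entry B k j))"
    by (intro bdd_aboveI[of _ "mat_norm A * mat_norm B"]) auto
  thus ?thesis unfolding entry_max_mult by (intro cSUP_upper) auto
qed

lemma entry_max_mult_le:
  assumes "\<And>k. entry A i k * entry B k j \<le> c"
  shows "entry (A \<otimes>\<^sub>m B) i j \<le> c"
  unfolding entry_max_mult by (rule cSUP_least) (use assms in auto)

text \<open>Local Lipschitz estimate behind the continuity of the product. Using the sum of both
  norms makes the bound symmetric under exchanging the two pairs, so a one-sided estimate
  suffices.\<close>

lemma dist_max_mult_le:
  "dist (A \<otimes>\<^sub>m B) (A' \<otimes>\<^sub>m B') \<le> (mat_norm A + mat_norm A') * dist B B' + dist A A' * (mat_norm B + mat_norm B')"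
proof -
  let ?c = "\<lambda>A B A' B'. (mat_norm A + mat_norm A') * dist B B' + dist A A' * (mat_norm B + mat_norm B')"
  have le: "entry (A \<otimes>\<^sub>m B) i j \<le> entry (A' \<otimes>\<^sub>m B') i j + ?c A B A' B'" for A B A' B' i j
  proof (rule entry_max_mult_le)
    fix k
    \<comment> \<open>The usual splitting
      \<open>a b - a' b' = a (b - b') + (a - a') b'\<close>.\<close>
    have "entry A i k * entry B k j = entry A' i k * entry B' k j
        + entry A i k * (entry B k j - entry B' k j) + (entry A i k - entry A' i k) * entry B' k j"
      by (simp add: algebra_simps)
    also have "\<dots> \<le> entry (A' \<otimes>\<^sub>m B') i j + (mat_norm A + mat_norm A') * dist B B'
        + dist A A' * (mat_norm B + mat_norm B')"
    proof (intro add_mono mult_le_entry_max_mult)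
      have "entry A i k * (entry B k j - entry B' k j) \<le> entry A i k * dist B B'"
        using abs_entry_diff_le_dist[of B k j B'] by (intro mult_left_mono entry_nonneg) auto
      also have "\<dots> \<le> (mat_norm A + mat_norm A') * dist B B'"
        using entry_le_mat_norm[of A i k] mat_norm_nonneg[of A'] by (intro mult_right_mono) auto
      finally show "entry A i k * (entry B k j - entry B' k j) \<le> (mat_norm A + mat_norm A') * dist B B'" .
      have "(entry A i k - entry A' i k) * entry B' k j \<le> dist A A' * entry B' k j"
        using abs_entry_diff_le_dist[of A i k A'] by (intro mult_right_mono entry_nonneg) auto
      also have "\<dots> \<le> dist A A' * (mat_norm B + mat_norm B')"
        using entry_le_mat_norm[of B' k j] mat_norm_nonneg[of B] by (intro mult_left_mono) auto
      finally show "(entry A i k - entry A' i k) * entry B' k j \<le> dist A A' * (mat_norm B + mat_norm B')" .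
    qed
    finally show "entry A i k * entry B k j \<le> entry (A' \<otimes>\<^sub>m B') i j + ?c A B A' B'" by simp
  qed
  show ?thesis
  proof (rule dist_bmat_le)
    fix i j
    have "?c A' B' A B = ?c A B A' B'" by (simp add: dist_commute add.commute)
    thus "\<bar>entry (A \<otimes>\<^sub>m B) i j - entry (A' \<otimes>\<^sub>m B') i j\<bar> \<le> ?c A B A' B'"
      using le[of A B i j A' B'] le[of A' B' i j A B] by linarith
  qed
qed

lemma tendsto_entry [tendsto_intros]:
  assumes "(f \<longlongrightarrow> A) F"
  shows "((\<lambda>x. entry (f x) i j) \<longlongrightarrow> entry A i j) F"
proof (rule metric_tendsto_imp_tendsto[OF assms])
  show "\<forall>\<^sub>F x in F. dist (entry (f x) i j) (entry A i j) \<le> dist (f x) A"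
    by (simp add: dist_real_def abs_entry_diff_le_dist)
qed

lemma tendsto_mat_norm [tendsto_intros]:
  assumes "(f \<longlongrightarrow> A) F"
  shows "((\<lambda>x. mat_norm (f x)) \<longlongrightarrow> mat_norm A) F"
proof (rule metric_tendsto_imp_tendsto[OF assms])
  show "\<forall>\<^sub>F x in F. dist (mat_norm (f x)) (mat_norm A) \<le> dist (f x) A"
    by (simp add: dist_real_def abs_mat_norm_diff_le_dist)
qed

lemma tendsto_max_mult [tendsto_intros]:
  assumes f: "(f \<longlongrightarrow> A) F" and g: "(g \<longlongrightarrow> B) F"
  shows "((\<lambda>x. f x \<otimes>\<^sub>m g x) \<longlongrightarrow> A \<otimes>\<^sub>m B) F"
proof -
  let ?c = "\<lambda>x. (mat_norm (f x) + mat_norm A) * dist (g x) B + dist (f x) A * (mat_norm (g x) + mat_norm B)"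
  have "(?c \<longlongrightarrow> (mat_norm A + mat_norm A) * dist B B + dist A A * (mat_norm B + mat_norm B)) F"
    by (intro tendsto_intros f g)
  hence "(?c \<longlongrightarrow> 0) F" by simp
  moreover have "\<forall>\<^sub>F x in F. norm (dist (f x \<otimes>\<^sub>m g x) (A \<otimes>\<^sub>m B)) \<le> ?c x"
    by (simp add: dist_max_mult_le)
  ultimately have "((\<lambda>x. dist (f x \<otimes>\<^sub>m g x) (A \<otimes>\<^sub>m B)) \<longlongrightarrow> 0) F"
    by (rule Lim_null_comparison[rotated])
  thus ?thesis by (rule tendsto_dist_iff[THEN iffD2])
qed

lemma tendsto_max_power [tendsto_intros]:
  assumes "(f \<longlongrightarrow> A) F"
  shows "((\<lambda>x. max_power (f x) k) \<longlongrightarrow> max_power A k) F"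
proof (induction k)
  case (Suc k)
  show ?case unfolding max_power.simps by (intro tendsto_max_mult assms Suc)
qed simp

lemma tendsto_path_weight [tendsto_intros]:
  assumes "(f \<longlongrightarrow> A) F"
  shows "((\<lambda>x. path_weight (f x) k p) \<longlongrightarrow> path_weight A k p) F"
  unfolding path_weight_def by (intro tendsto_intros assms)

section \<open>Path weights and powers\<close>

lemma path_weight_nonneg: "0 \<le> path_weight A k p"
  unfolding path_weight_def by (intro prod_nonneg) (simp add: entry_nonneg)

lemma path_weight_Suc: "path_weight A (Suc k) p = entry A (p (Suc k)) (p k) * path_weight A k p"
  by (simp add: path_weight_def)

text \<open>The path is cut at its vertex \<open>p n\<close>: the right factor covers the first
  \<open>n\<close> steps, the left factor the remaining \<open>m\<close>.\<close>

lemma path_weight_add: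
  "path_weight A (m + n) p = path_weight A m (\<lambda>t. p (t + n)) * path_weight A n p"
proof (induction m)
  case 0
  show ?case by (simp add: path_weight_def)
next
  case (Suc m)
  thus ?case by (simp add: path_weight_Suc)
qed

lemma path_weight_cong:
  assumes "\<And>t. t \<le> k \<Longrightarrow> p t = p' t"
  shows "path_weight A k p = path_weight A k p'"
  unfolding path_weight_def by (intro prod.cong) (use assms in auto)

lemma path_weight_le_entry_max_power: "path_weight A k p \<le> entry (max_power A k) (p k) (p 0)"
proof (induction k)
  case (Suc k)
  have "path_weight A (Suc k) p \<le> entry A (p (Suc k)) (p k) * entry (max_power A k) (p k) (p 0)"
    unfolding path_weight_Suc by (intro mult_left_mono Suc entry_nonneg)
  also have "\<dots> \<le> entry (max_power A (Suc k)) (p (Suc k)) (p 0)"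
    unfolding max_power.simps by (rule mult_le_entry_max_mult)
  finally show ?case .
qed (simp add: path_weight_def entry_max_one)

text \<open>Counterpart of \<open>path_weight_le_entry_max_power\<close>: bounds on path weights
  pass to entries of powers. Only the end vertex is prescribed, which is enough for bounding norms.
  The induction generalizes \<open>c\<close>, since it passes to
  \<open>c / entry A i l\<close>.\<close>

lemma entry_max_power_le:
  assumes "0 \<le> c" and "\<And>p. p k = i \<Longrightarrow> path_weight A k p \<le> c"
  shows "entry (max_power A k) i j \<le> c"
  using assms
proof (induction k arbitrary: i c)
  case 0
  from 0(2)[of "\<lambda>_. i"] 0(1) show ?case by (simp add: path_weight_def entry_max_one)
next
  case (Suc k)
  have "entry A i l * entry (max_power A k) l j \<le> c" for l
  proof (cases "entry A i l = 0")
    case False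
    hence pos: "0 < entry A i l" using entry_nonneg[of A i l] by linarith
    have "entry (max_power A k) l j \<le> c / entry A i l"
    proof (rule Suc.IH)
      fix p :: "nat \<Rightarrow> nat" assume p: "p k = l"
      \<comment> \<open>Prolonging \<open>p\<close> by a last step from \<open>l\<close> to
        \<open>i\<close> makes the hypothesis for length \<open>Suc k\<close> applicable.\<close>
      define p' where "p' = p(Suc k := i)"
      have "path_weight A k p' = path_weight A k p"
        by (rule path_weight_cong) (simp add: p'_def)
      hence "path_weight A (Suc k) p' = entry A i l * path_weight A k p"
        using p by (simp add: path_weight_Suc p'_def)
      moreover have "path_weight A (Suc k) p' \<le> c"
        by (rule Suc.prems) (simp add: p'_def)
      ultimately show "path_weight A k p \<le> c / entry A i l"
        using pos by (simp add: pos_le_divide_eq mult.commute)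
    qed (use Suc.prems pos in auto)
    thus ?thesis using pos by (simp add: pos_le_divide_eq mult.commute)
  qed (use Suc.prems in auto)
  thus ?case by (auto intro: entry_max_mult_le)
qed

lemma path_weight_le_mat_norm: "path_weight A k p \<le> mat_norm (max_power A k)"
  using path_weight_le_entry_max_power entry_le_mat_norm by (rule order_trans)

text \<open>Obtained by cutting paths of length \<open>m + n\<close> in two rather than from
  associativity of the product.\<close>

lemma mat_norm_max_power_add:
  "mat_norm (max_power A (m + n)) \<le> mat_norm (max_power A m) * mat_norm (max_power A n)"
proof (rule mat_norm_le, rule entry_max_power_le)
  fix p :: "nat \<Rightarrow> nat"
  show "path_weight A (m + n) p \<le> mat_norm (max_power A m) * mat_norm (max_power A n)"
    unfolding path_weight_add
    by (intro mult_mono path_weight_le_mat_norm mat_norm_nonneg path_weight_nonneg)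
qed (simp add: mat_norm_nonneg)

lemma path_weight_iterate_cycle:
  assumes "1 \<le> k" and "p k = p 0"
  shows "path_weight A (n * k) (\<lambda>t. p (t mod k)) = path_weight A k p ^ n"
proof (induction n)
  case (Suc n)
  \<comment> \<open>The two paths agree also at \<open>t = k\<close>, where the index wraps to 0,
    because \<open>p\<close> is closed.\<close>
  have "path_weight A k (\<lambda>t. p (t mod k)) = path_weight A k p"
    by (rule path_weight_cong) (use assms in \<open>auto simp: le_less\<close>)
  with Suc show ?case by (simp add: path_weight_add)
qed (simp add: path_weight_def)

section \<open>Semicontinuity\<close>

lemma root_mat_norm_LIMSEQ_INF:
  "(\<lambda>k. root k (mat_norm (max_power A k))) \<longlonglongrightarrow> (INF k\<in>{1..}. root k (mat_norm (max_power A k)))"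
  by (rule submultiplicative_root_LIMSEQ) (fact mat_norm_nonneg mat_norm_max_power_add)+

lemma spectral_radius_eq_INF:
  "spectral_radius A = (INF k\<in>{1..}. root k (mat_norm (max_power A k)))"
  unfolding spectral_radius_def by (rule limI[OF root_mat_norm_LIMSEQ_INF])

lemma spectral_radius_LIMSEQ:
  "(\<lambda>k. root k (mat_norm (max_power A k))) \<longlonglongrightarrow> spectral_radius A"
  unfolding spectral_radius_eq_INF by (rule root_mat_norm_LIMSEQ_INF)

lemma bdd_below_root_mat_norm: "bdd_below ((\<lambda>k. root k (mat_norm (max_power A k))) ` {1..})"
  by (rule bdd_belowI[of _ 0]) (auto simp: mat_norm_nonneg)

lemma cycle_means_nonempty: "{root k (path_weight A k i) | k i. 1 \<le> k \<and> i k = i 0} \<noteq> {}"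
  using order_refl[of "1::nat"] by fast

text \<open>Running \<open>n\<close> times around a cycle of length \<open>k\<close> and weight
  \<open>w\<close> shows that the power with exponent \<open>n * k\<close> has norm at least
  \<open>w ^ n\<close>. Its root of order \<open>n * k\<close> is thus at least
  \<open>root k w\<close>, a bound that survives the limit.\<close>

lemma cycle_mean_sup_le_spectral_radius: "cycle_mean_sup A \<le> spectral_radius A"
  unfolding cycle_mean_sup_def
proof (rule cSup_least[OF cycle_means_nonempty], clarify)
  fix k :: nat and p :: "nat \<Rightarrow> nat"
  assume k: "1 \<le> k" and p: "p k = p 0"
  \<comment> \<open>The factor \<open>Suc n\<close> keeps the order of the root positive at
    \<open>n = 0\<close>.\<close>
  have "(\<lambda>n. root (Suc n * k) (mat_norm (max_power A (Suc n * k)))) \<longlonglongrightarrow> spectral_radius A"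
  proof (rule LIMSEQ_subseq_LIMSEQ[OF spectral_radius_LIMSEQ, unfolded o_def])
    show "strict_mono (\<lambda>n. Suc n * k)" using k by (auto intro: strict_monoI)
  qed
  thus "root k (path_weight A k p) \<le> spectral_radius A"
  proof (rule LIMSEQ_le_const, intro exI allI impI)
    fix n :: nat
    have "root k (path_weight A k p) = root (Suc n * k) (path_weight A k p ^ Suc n)"
      using k path_weight_nonneg[of A k p]
      by (simp add: real_root_mult_exp real_root_power_cancel mult.commute[of _ k]
          del: mult_Suc mult_Suc_right power_Suc)
    also have "\<dots> \<le> root (Suc n * k) (mat_norm (max_power A (Suc n * k)))"
      unfolding path_weight_iterate_cycle[of k p, OF k p, symmetric]
      using k by (intro real_root_le_mono path_weight_le_mat_norm) auto
    finally show "root k (path_weight A k p) \<le> root (Suc n * k) (mat_norm (max_power A (Suc n * k)))" .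
  qed
qed

lemma spectral_radius_upper_semicontinuous:
  assumes "spectral_radius A < x"
  shows "\<forall>\<^sub>F B in at A. spectral_radius B < x"
proof -
  \<comment> \<open>One exponent that witnesses the strict bound at \<open>A\<close> still does so
    for all nearby \<open>B\<close>.\<close>
  obtain k where k: "1 \<le> k" "root k (mat_norm (max_power A k)) < x"
    using assms cINF_less_iff[OF _ bdd_below_root_mat_norm] unfolding spectral_radius_eq_INF by auto
  have "((\<lambda>B. root k (mat_norm (max_power B k))) \<longlongrightarrow> root k (mat_norm (max_power A k))) (at A)"
    by (intro tendsto_intros)
  from order_tendstoD(2)[OF this k(2)] show ?thesis
  proof eventually_elim
    case (elim B)
    have "spectral_radius B \<le> root k (mat_norm (max_power B k))"
      unfolding spectral_radius_eq_INF using k by (intro cINF_lower bdd_below_root_mat_norm) auto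
    with elim show ?case by simp
  qed
qed

lemma cycle_mean_sup_lower_semicontinuous:
  assumes "x < cycle_mean_sup A"
  shows "\<forall>\<^sub>F B in at A. x < cycle_mean_sup B"
proof -
  \<comment> \<open>Likewise, one fixed cycle whose mean exceeds \<open>x\<close> at
    \<open>A\<close> serves for all nearby \<open>B\<close>.\<close>
  obtain k p where k: "1 \<le> k" and p: "p k = p 0" and x: "x < root k (path_weight A k p)"
    using assms less_cSup_iff[OF cycle_means_nonempty bdd_above_cycle_means]
    unfolding cycle_mean_sup_def by blast
  have "((\<lambda>B. root k (path_weight B k p)) \<longlongrightarrow> root k (path_weight A k p)) (at A)"
    by (intro tendsto_intros)
  from order_tendstoD(1)[OF this x] show ?thesis
  proof eventually_elim
    case (elim B)
    have "root k (path_weight B k p) \<le> cycle_mean_sup B"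
      unfolding cycle_mean_sup_def using k p by (intro cSup_upper bdd_above_cycle_means) blast
    with elim show ?case by simp
  qed
qed

theorem corollary5p8:
  fixes A :: bmat
  assumes "cycle_mean_sup A = spectral_radius A"
  shows "isCont spectral_radius A \<and> isCont cycle_mean_sup A"
  unfolding isCont_def
proof (intro conjI order_tendstoI)
  \<comment> \<open>By the assumption \<open>x\<close> also lies below
    \<open>cycle_mean_sup A\<close>, hence below \<open>cycle_mean_sup B\<close>, and so below
    \<open>spectral_radius B\<close>, for \<open>B\<close> near \<open>A\<close>.\<close>
  show "\<forall>\<^sub>F B in at A. x < spectral_radius B" if "x < spectral_radius A" for x
    using that cycle_mean_sup_le_spectral_radius
    by (intro eventually_mono[OF cycle_mean_sup_lower_semicontinuous[of x]])
      (simp_all add: assms less_le_trans)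
  \<comment> \<open>The mirror image: the upper bound on \<open>spectral_radius B\<close> is
    inherited by \<open>cycle_mean_sup B\<close>.\<close>
  show "\<forall>\<^sub>F B in at A. cycle_mean_sup B < x" if "cycle_mean_sup A < x" for x
    using that cycle_mean_sup_le_spectral_radius
    by (intro eventually_mono[OF spectral_radius_upper_semicontinuous[of _ x]])
      (simp_all add: assms[symmetric], meson le_less_trans)
\<comment> \<open>The other two one-sided bounds hold at every matrix.\<close>
qed (fact spectral_radius_upper_semicontinuous cycle_mean_sup_lower_semicontinuous)+

end
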